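(* For all integers $d,n\ge 0$ we have $|\mathrm{dA}_n|\le |\mathrm{Av}_n(\sigma_{d+3})|$.
   Context: $d$-ascent sequences. For a sequence $\alpha=a_1a_2\ldots a_n$ of nonnegative integers and $d\ge 0$, an index $k\in\{1,\dots,n-1\}$ is a $d$-ascent of $\alpha$ if $a_{k+1}>a_k-d$; $\mathrm{dasc}\,\alpha$ is the number of $d$-ascents of $\alpha$. Write $\alpha_k=a_1\ldots a_k$. The sequence $\alpha$ is a $d$-ascent sequence if $a_1=0$ and $a_{k+1}\le 1+\mathrm{dasc}\,\alpha_k$ for $k\in\{1,\dots,n-1\}$. $\mathrm{dA}_n$ is the set of $d$-ascent sequences of length $n$ (for $n=0$, just the empty sequence). The pattern $\sigma_{d+3}$. Permutations $\pi=p_1p_2\ldots p_n$ of $\{1,\dots,n\}$ are written in one-line notation. The bivincular pattern $\sigma_{d+3}=(d+2)\,|\,(d+3)\;1\;2\;\ldots\;\overline{(d+1)}$ is the permutation $(d+2)(d+3)12\ldots(d+1)$ where the bar means that, in a copy, the elements playing the roles of $d+2$ and $d+3$ must be adjacent in position, and the overline means that the elements playing the roles of $d+1$ and $d+2$ must be consecutive integers. Explicitly, $\pi$ contains $\sigma_{d+3}$ if there are indices $i$ and $i+1<j_1<j_2<\dots<j_{d+1}$ with $p_i<p_{i+1}$, $p_{j_1}<p_{j_2}<\dots<p_{j_{d+1}}$, and $p_{j_{d+1}}=p_i-1$; otherwise $\pi$ avoids it. $\mathrm{Av}_n(\sigma_{d+3})$ is the set of permutations of $\{1,\dots,n\}$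 avoiding $\sigma_{d+3}$. *)

theory Defs
  imports "HOL-Combinatorics.Multiset_Permutations"
begin

text \<open>
  Sequences and permutations in one-line notation are lists, so indices are shifted by one:
  \<open>a\<^sub>k\<close> is \<open>a ! (k - 1)\<close>, and the prefix \<open>a\<^sub>1 \<dots> a\<^sub>k\<close> is \<open>take k a\<close>.
\<close>

definition d_ascents :: "nat \<Rightarrow> nat list \<Rightarrow> nat set" where
  "d_ascents d a = {k. Suc k < length a \<and> int (a ! Suc k) > int (a ! k) - int d}"

definition dasc :: "nat \<Rightarrow> nat list \<Rightarrow> nat" where
  "dasc d a = card (d_ascents d a)"

definition d_ascent_sequence :: "nat \<Rightarrow> nat list \<Rightarrow> bool" where
  "d_ascent_sequence d a \<longleftrightarrow>
     (a \<noteq> [] \<longrightarrow> a ! 0 = 0) \<and>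
     (\<forall>k. 1 \<le> k \<and> k < length a \<longrightarrow> a ! k \<le> 1 + dasc d (take k a))"

definition dA :: "nat \<Rightarrow> nat \<Rightarrow> nat list set" where
  "dA d n = {a. length a = n \<and> d_ascent_sequence d a}"

text \<open>
  In \<open>contains_sigma\<close>, the list \<open>js\<close> holds the positions \<open>j\<^sub>1 < \<dots> < j\<^sub>d\<^sub>+\<^sub>1\<close>.
  The condition that \<open>p\<close> at the last of them equals \<open>p\<^sub>i - 1\<close> is written with \<open>Suc\<close>
  to avoid truncated subtraction.
\<close>

definition contains_sigma :: "nat \<Rightarrow> nat list \<Rightarrow> bool" where
  "contains_sigma d p \<longleftrightarrow>
     (\<exists>i js. length js = d + 1 \<and> sorted_wrt (<) js \<and> set js \<subseteq> {..<length p} \<and>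
        i + 1 < hd js \<and>
        p ! i < p ! (i + 1) \<and>
        sorted_wrt (<) (map (\<lambda>j. p ! j) js) \<and>
        p ! i = Suc (p ! last js))"

definition Av_sigma :: "nat \<Rightarrow> nat \<Rightarrow> nat list set" where
  "Av_sigma d n = {p \<in> permutations_of_set {1..n}. \<not> contains_sigma d p}"

text \<open>Both sets are finite, so \<^const>\<open>card\<close> is their genuine cardinality.\<close>

lemma finite_dA: "finite (dA d n)"
proof (rule finite_subset)
  show "dA d n \<subseteq> {a. set a \<subseteq> {..1 + n} \<and> length a = n}"
  proof safe
    fix a x assume a: "a \<in> dA d n" and "x \<in> set a"
    then obtain k where k: "k < n" "x = a ! k"
      by (auto simp: dA_def in_set_conv_nth)
    have "dasc d (take k a) \<le> card {..<k}"
      unfolding dasc_def d_ascents_def by (rule card_mono) auto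
    then have "dasc d (take k a) \<le> k" by simp
    with a k have "x \<le> 1 + n" if "1 \<le> k"
      using that by (fastforce simp: dA_def d_ascent_sequence_def)
    moreover from a k have "x = 0" if "k = 0"
      using that by (auto simp: dA_def d_ascent_sequence_def)
    ultimately show "x \<le> 1 + n"
      by (cases "k = 0") auto
  qed (simp add: dA_def)
  show "finite {a::nat list. set a \<subseteq> {..1 + n} \<and> length a = n}"
    by (rule finite_lists_length_eq) simp
qed

lemma finite_Av_sigma: "finite (Av_sigma d n)"
  by (simp add: Av_sigma_def)

end

theory Submission
  imports Defs "HOL-Library.Sublist"
begin

text \<open>
  The inequality comes from an injection that builds a permutation by inserting \<open>1, 2, \<dots>, n\<close>
  one at a time, the entry \<open>a\<^sub>k\<close> telling where the maximum \<open>k\<close> goes. The permutation is kept as a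
  list of blocks whose concatenation is the permutation, and \<open>k\<close> is put directly in front of the
  block with index \<open>a\<^sub>k\<close>. If \<open>k = 1\<close> or \<open>k - 1\<close> is a \<open>d\<close>-ascent then \<open>k\<close> becomes a block of its
  own, otherwise it joins the block that it precedes. Hence every \<open>d\<close>-ascent creates one more block, and the number
  of blocks is the number of values that the next entry of a \<open>d\<close>-ascent sequence may take.

  New elements are maximal and enter at the front of a block, so every block is decreasing. This
  has two consequences. First, an ascent of the permutation between adjacent positions can only
  occur at the border of two blocks, so the element \<open>m\<close> that plays the role of \<open>d + 2\<close> in a copy of
  the pattern closes a block, which means that it was inserted with a \<open>d\<close>-ascent (or is \<open>1\<close>, which
  has nothing below it). Second, an increasing subsequence meets each block at most once. When such
  an \<open>m\<close> is inserted, the element \<open>m - 1\<close> stands at the front of the block with index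
  \<open>a\<^sub>m\<^sub>-\<^sub>1 < a\<^sub>m + d\<close>. If \<open>a\<^sub>m\<^sub>-\<^sub>1 < a\<^sub>m\<close> it lies to the left of \<open>m\<close>; otherwise an increasing
  subsequence to the right of \<open>m\<close> that ends in \<open>m - 1\<close> has at most \<open>a\<^sub>m\<^sub>-\<^sub>1 - a\<^sub>m + 1 \<le> d\<close>
  elements. Later insertions are too large to extend it. So the pattern is avoided
  (\<open>blocks_invariant\<close>, \<open>good_avoids\<close>).

  The map is injective because deleting the maximum recovers the previous permutation, by induction
  the previous sequence and its blocks, and then the place of the maximum determines the last entry:
  only the final block can be empty, so different indices give different places.
\<close>

section \<open>\<open>d\<close>-ascent sequences extended on the right\<close>

lemma dasc_snoc:
  "dasc d (\<alpha> @ [a]) = dasc d \<alpha> + (if \<alpha> \<noteq> [] \<and> last \<alpha> < a + d then 1 else 0)"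
proof (cases "\<alpha> = []")
  case True
  then show ?thesis by (simp add: dasc_def d_ascents_def)
next
  case False
  have "d_ascents d (\<alpha> @ [a]) =
      d_ascents d \<alpha> \<union> (if last \<alpha> < a + d then {length \<alpha> - 1} else {})"
  proof (rule set_eqI)
    fix k
    have "last \<alpha> = \<alpha> ! k" if "Suc k = length \<alpha>"
      using False by (simp add: last_conv_nth flip: that)
    then show "k \<in> d_ascents d (\<alpha> @ [a]) \<longleftrightarrow>
        k \<in> d_ascents d \<alpha> \<union> (if last \<alpha> < a + d then {length \<alpha> - 1} else {})"
      using False by (cases "Suc k" "length \<alpha>" rule: linorder_cases)
        (auto simp: d_ascents_def nth_append)
  qed
  moreover have "length \<alpha> - 1 \<notin> d_ascents d \<alpha>"
    using False by (auto simp: d_ascents_def)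
  moreover have "finite (d_ascents d \<alpha>)"
    by (rule finite_subset[of _ "{..<length \<alpha>}"]) (auto simp: d_ascents_def)
  ultimately show ?thesis
    using False by (simp add: dasc_def)
qed

lemma d_ascent_sequence_snoc:
  "d_ascent_sequence d (\<alpha> @ [a]) \<longleftrightarrow>
     d_ascent_sequence d \<alpha> \<and> a \<le> (if \<alpha> = [] then 0 else 1 + dasc d \<alpha>)"
proof (cases "\<alpha> = []")
  case True
  then show ?thesis by (simp add: d_ascent_sequence_def)
next
  case False
  have prefix: "take k (\<alpha> @ [a]) = take k \<alpha>" if "k \<le> length \<alpha>" for k
    using that by simp
  have "(\<forall>k. 1 \<le> k \<and> k < length (\<alpha> @ [a]) \<longrightarrow> (\<alpha> @ [a]) ! k \<le> 1 + dasc d (take k (\<alpha> @ [a])))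
    \<longleftrightarrow> (\<forall>k. 1 \<le> k \<and> k < length \<alpha> \<longrightarrow> \<alpha> ! k \<le> 1 + dasc d (take k \<alpha>)) \<and> a \<le> 1 + dasc d \<alpha>"
    (is "(\<forall>k. ?L k) \<longleftrightarrow> (\<forall>k. ?R k) \<and> ?A")
  proof (intro iffI conjI allI)
    fix k assume L: "\<forall>k. ?L k"
    show "?R k"
      using L[rule_format, of k] prefix[of k] by (auto simp: nth_append)
  next
    assume L: "\<forall>k. ?L k"
    show ?A
      using L[rule_format, of "length \<alpha>"] False by (simp add: Suc_le_eq)
  next
    fix k assume R: "(\<forall>k. ?R k) \<and> ?A"
    show "?L k"
      using R prefix[of k] by (cases "k = length \<alpha>") (auto simp: nth_append)
  qed
  then show ?thesis
    using False by (simp add: d_ascent_sequence_def nth_append)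
qed

section \<open>Increasing subsequences that obstruct a position\<close>

text \<open>
  An element \<open>m\<close> followed immediately by a larger element and then by a list that satisfies
  this predicate starts an occurrence of the pattern.
\<close>

definition has_increasing_below :: "nat \<Rightarrow> nat \<Rightarrow> nat list \<Rightarrow> bool" where
  "has_increasing_below d m xs \<longleftrightarrow>
     (\<exists>zs. subseq zs xs \<and> sorted_wrt (<) zs \<and> length zs = Suc d \<and> Suc (last zs) = m)"

lemma has_increasing_below_mono:
  "has_increasing_below d m xs \<Longrightarrow> subseq xs ys \<Longrightarrow> has_increasing_below d m ys"
  unfolding has_increasing_below_def using subseq_order.trans[of _ xs ys] by blast

text \<open>
  All elements of an obstructing subsequence are smaller than \<open>m\<close>, so elements from \<open>m\<close> upwards
  can be deleted from or inserted into the list without affecting it.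
\<close>

lemma has_increasing_below_remove:
  assumes "has_increasing_below d m (xs @ n # ys)" and "m \<le> n"
  shows "has_increasing_below d m (xs @ ys)"
proof -
  obtain zs where zs: "subseq zs (xs @ n # ys)" "sorted_wrt (<) zs" "length zs = Suc d"
      "Suc (last zs) = m"
    using assms(1) unfolding has_increasing_below_def by blast
  have "zs = butlast zs @ [last zs]"
    using zs(3) by (metis append_butlast_last_id list.size(3) nat.distinct(1))
  then have "\<forall>z\<in>set zs. z \<le> last zs"
    using zs(2) by (metis Un_iff empty_iff empty_set insert_iff less_imp_le list.simps(15)
        order_refl set_append sorted_wrt_append)
  then have n: "n \<notin> set zs"
    using zs(4) assms(2) by auto
  obtain z1 z2 where z12: "zs = z1 @ z2" "subseq z1 xs" "subseq z2 (n # ys)"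
    using zs(1) by (rule subseq_appendE)
  have "subseq z2 ys"
    using z12(1,3) n by (cases z2) (auto split: if_splits)
  then have "subseq zs (xs @ ys)"
    using z12 by (simp add: list_emb_append_mono)
  then show ?thesis
    using zs unfolding has_increasing_below_def by blast
qed

lemma increasing_subseq_of_decreasing:
  fixes zs b :: "nat list"
  assumes "subseq zs b" "sorted_wrt (>) b" "sorted_wrt (<) zs"
  shows "length zs \<le> 1"
proof (rule ccontr)
  assume "\<not> length zs \<le> 1"
  then obtain x y r where "zs = x # y # r"
    by (cases zs; cases "tl zs") auto
  moreover have "sorted_wrt (>) zs"
    using assms(1,2) by (induction rule: list_emb.induct) (auto dest: list_emb_set)
  ultimately show False using assms(3) by auto
qed

text \<open>An increasing subsequence takes at most one element from each decreasing block.\<close>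

lemma increasing_subseq_of_decreasing_blocks:
  fixes Bs :: "nat list list"
  assumes "subseq zs (concat Bs)" "\<forall>b\<in>set Bs. sorted_wrt (>) b" "sorted_wrt (<) zs"
  shows "length zs \<le> length Bs"
  using assms
proof (induction Bs arbitrary: zs)
  case (Cons b Bs)
  then obtain z1 z2 where z: "zs = z1 @ z2" "subseq z1 b" "subseq z2 (concat Bs)"
    by (auto elim: subseq_appendE)
  have "length z1 \<le> 1" "length z2 \<le> length Bs"
    using Cons z increasing_subseq_of_decreasing[of z1 b] by (auto simp: sorted_wrt_append)
  then show ?case using z by simp
qed simp

text \<open>
  Whatever follows the last element of the subsequence cannot contribute, so only the blocks
  up to the one that starts with this element count.
\<close>

lemma increasing_below_le_blocks:
  assumes "has_increasing_below d (Suc x) (concat (P @ (x # c) # Q))"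
    and "\<forall>b\<in>set P. sorted_wrt (>) b" and "x \<notin> set c" "x \<notin> set (concat Q)"
  shows "d \<le> length P"
proof -
  obtain zs where zs: "subseq zs ((concat P @ [x]) @ c @ concat Q)" "sorted_wrt (<) zs"
      "length zs = Suc d" "last zs = x"
    using assms(1) unfolding has_increasing_below_def by auto
  obtain z1 z2 where z: "zs = z1 @ z2" "subseq z1 (concat P @ [x])" "subseq z2 (c @ concat Q)"
    using zs(1) by (rule subseq_appendE)
  have "z2 = []"
  proof (rule ccontr)
    assume "z2 \<noteq> []"
    then have "x \<in> set z2" using z(1) zs(4) by (auto simp: last_append)
    then obtain y where "y \<in> set (c @ concat Q)" "x = y"
      using list_emb_set[OF z(3)] by blast
    then show False using assms(3,4) by auto
  qed
  then have "subseq zs (concat (P @ [[x]]))"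
    using z by simp
  then have "length zs \<le> length (P @ [[x]])"
    using zs(2) assms(2) by (intro increasing_subseq_of_decreasing_blocks) auto
  then show ?thesis using zs(3) by simp
qed

section \<open>Good block lists\<close>

text \<open>
  In a good block list every position between two blocks is one where a larger element may
  follow without completing the pattern.
\<close>

fun good :: "nat \<Rightarrow> nat list list \<Rightarrow> bool" where
  "good d [] \<longleftrightarrow> True"
| "good d (b # Q) \<longleftrightarrow> sorted_wrt (>) b \<and>
     (Q \<noteq> [] \<longrightarrow> b \<noteq> [] \<and> \<not> has_increasing_below d (last b) (concat Q)) \<and> good d Q"

lemma good_decreasing: "good d B \<Longrightarrow> b \<in> set B \<Longrightarrow> sorted_wrt (>) b"
  by (induction B) auto

lemma good_nonempty: "good d (P @ b # Q) \<Longrightarrow> Q \<noteq> [] \<Longrightarrow> b \<noteq> []"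
  by (induction P) auto

lemma good_join:
  assumes "good d (P @ b # Q)" and "\<forall>x\<in>set (concat (P @ b # Q)). x < n"
  shows "good d (P @ (n # b) # Q)"
  using assms
proof (induction P)
  case (Cons c P)
  have "c \<noteq> []" using Cons.prems(1) by simp
  then have "last c < n" using Cons.prems(2) by simp
  then have "\<not> has_increasing_below d (last c) (concat (P @ (n # b) # Q))"
    using Cons.prems(1) has_increasing_below_remove[of d "last c" "concat P" n "b @ concat Q"]
    by auto
  then show ?case using Cons by auto
qed auto

lemma good_new_block:
  assumes "good d (P @ b # Q)" and "\<forall>x\<in>set (concat (P @ b # Q)). x < n"
    and "\<not> has_increasing_below d n (concat (b # Q))"
  shows "good d (P @ [n] # b # Q)"
  using assms
proof (induction P)
  case (Cons c P)
  have "c \<noteq> []" using Cons.prems(1) by simp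
  then have "last c < n" using Cons.prems(2) by simp
  then have "\<not> has_increasing_below d (last c) (concat (P @ [n] # b # Q))"
    using Cons.prems(1) has_increasing_below_remove[of d "last c" "concat P" n "b @ concat Q"]
    by auto
  then show ?case using Cons by auto
qed auto

text \<open>Since blocks decrease, an adjacent ascent can only straddle a border between blocks.\<close>

lemma good_ascent:
  assumes "good d B" and "concat B = xs @ m # m' # ys" and "m < m'"
  shows "\<not> has_increasing_below d m (m' # ys)"
  using assms(1,2)
proof (induction B arbitrary: xs)
  case (Cons b Q)
  from Cons.prems(2) have "b @ concat Q = xs @ m # m' # ys" by simp
  then consider us where "b @ us = xs" "concat Q = us @ m # m' # ys"
    | us where "b = xs @ us" "us @ concat Q = m # m' # ys"
    by (auto simp: append_eq_append_conv2)
  then show ?case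
  proof cases
    case 1
    then show ?thesis using Cons by auto
  next
    case (2 us)
    then consider "us = []" | "us = [m]" | vs where "us = m # m' # vs"
      by (cases us; cases "tl us") auto
    then show ?thesis
    proof cases
      case 1
      then show ?thesis using 2 Cons.IH[of "[]"] Cons.prems(1) by auto
    next
      case us: 2
      then have "concat Q = m' # ys" "last b = m" using 2 by auto
      then show ?thesis using Cons.prems(1) by auto
    next
      case 3
      then show ?thesis using 2 Cons.prems(1) assms(3) by (auto simp: sorted_wrt_append)
    qed
  qed
qed simp

lemma subseq_map_nth_drop:
  assumes "sorted_wrt (<) js" "\<forall>j\<in>set js. k \<le> j \<and> j < length xs"
  shows "subseq (map ((!) xs) js) (drop k xs)"
  using assms
proof (induction js arbitrary: k)
  case (Cons j js)
  have "subseq (map ((!) xs) js) (drop (Suc j) xs)"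
    using Cons by (auto simp: Suc_le_eq)
  then have "subseq (map ((!) xs) (j # js)) (drop j xs)"
    using Cons.prems(2) by (simp flip: Cons_nth_drop_Suc)
  moreover have "drop j xs = drop (j - k) (drop k xs)"
    using Cons.prems(2) by simp
  then have "subseq (drop j xs) (drop k xs)"
    by (metis suffix_drop suffix_imp_subseq)
  ultimately show ?case by (meson subseq_order.trans)
qed simp

lemma good_avoids:
  assumes "good d B"
  shows "\<not> contains_sigma d (concat B)"
proof
  let ?p = "concat B"
  assume "contains_sigma d ?p"
  then obtain i js where js: "length js = d + 1" "sorted_wrt (<) js" "set js \<subseteq> {..<length ?p}"
      "i + 1 < hd js" "?p ! i < ?p ! (i + 1)" "sorted_wrt (<) (map (\<lambda>j. ?p ! j) js)"
      "?p ! i = Suc (?p ! last js)"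
    unfolding contains_sigma_def by blast
  have ne: "js \<noteq> []" using js(1) by auto
  then have ge: "\<forall>j\<in>set js. i + 1 < j"
    using js(2,4) by (cases js) auto
  then have len: "i + 1 < length ?p"
    using js(3) ne by (metis hd_in_set js(4) lessThan_iff less_trans subsetD)
  have "subseq (map ((!) ?p) js) (drop (i + 2) ?p)"
    using js(2,3) ge by (intro subseq_map_nth_drop) auto
  then have "has_increasing_below d (?p ! i) (drop (i + 2) ?p)"
    unfolding has_increasing_below_def using js ne by (auto simp: last_map)
  then have "has_increasing_below d (?p ! i) (?p ! (i + 1) # drop (i + 2) ?p)"
    by (rule has_increasing_below_mono) auto
  moreover have "?p = take i ?p @ ?p ! i # ?p ! (i + 1) # drop (i + 2) ?p"
    using len by (simp add: Cons_nth_drop_Suc)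
  ultimately show False
    using good_ascent[OF assms _ js(5)] by blast
qed

section \<open>The insertion map\<close>

definition join_block :: "nat \<Rightarrow> nat \<Rightarrow> nat list list \<Rightarrow> nat list list" where
  "join_block n a B = take a B @ (n # B ! a) # drop (Suc a) B"

definition new_block :: "nat \<Rightarrow> nat \<Rightarrow> nat list list \<Rightarrow> nat list list" where
  "new_block n a B = take a B @ [n] # drop a B"

text \<open>
  The recursion consumes a sequence from its right end, so it runs on the reversed sequence.
  The single empty block at the start offers the one place where \<open>1\<close> can go.
\<close>

fun rev_blocks :: "nat \<Rightarrow> nat list \<Rightarrow> nat list list" where
  "rev_blocks d [] = [[]]"
| "rev_blocks d (a # r) =
     (if r = [] \<or> hd r < a + d then new_block else join_block) (Suc (length r)) a (rev_blocks d r)"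

definition blocks :: "nat \<Rightarrow> nat list \<Rightarrow> nat list list" where
  "blocks d \<alpha> = rev_blocks d (rev \<alpha>)"

lemma blocks_Nil: "blocks d [] = [[]]"
  by (simp add: blocks_def)

lemma blocks_snoc:
  "blocks d (\<alpha> @ [a]) =
     (if \<alpha> = [] \<or> last \<alpha> < a + d then new_block else join_block) (Suc (length \<alpha>)) a (blocks d \<alpha>)"
  by (simp add: blocks_def hd_rev)

lemma concat_blocks_snoc:
  assumes "a < length (blocks d \<alpha>)"
  shows "concat (blocks d (\<alpha> @ [a])) =
    concat (take a (blocks d \<alpha>)) @ Suc (length \<alpha>) # concat (drop a (blocks d \<alpha>))"
proof -
  have "drop a (blocks d \<alpha>) = blocks d \<alpha> ! a # drop (Suc a) (blocks d \<alpha>)"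
    using assms by (simp add: Cons_nth_drop_Suc)
  then show ?thesis by (simp add: blocks_snoc new_block_def join_block_def)
qed

text \<open>
  The last two clauses are what the induction needs to control the next step: the number of
  blocks bounds the next entry, and the current maximum stands in front of the block that the
  last entry names.
\<close>

lemma blocks_invariant:
  assumes "d_ascent_sequence d \<alpha>"
  shows "good d (blocks d \<alpha>) \<and>
    distinct (concat (blocks d \<alpha>)) \<and> set (concat (blocks d \<alpha>)) = {1..length \<alpha>} \<and>
    length (blocks d \<alpha>) = (if \<alpha> = [] then 1 else dasc d \<alpha> + 2) \<and>
    (\<alpha> \<noteq> [] \<longrightarrow> (\<exists>P c Q. blocks d \<alpha> = P @ (length \<alpha> # c) # Q \<and> length P = last \<alpha>))"
  using assms
proof (induction \<alpha> rule: rev_induct)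
  case Nil
  then show ?case by (simp add: blocks_Nil)
next
  case (snoc a \<alpha>)
  let ?B = "blocks d \<alpha>" and ?n = "Suc (length \<alpha>)"
  have seq: "d_ascent_sequence d \<alpha>" and a: "a \<le> (if \<alpha> = [] then 0 else 1 + dasc d \<alpha>)"
    using snoc.prems by (auto simp: d_ascent_sequence_snoc)
  have IH: "good d ?B" "distinct (concat ?B)" "set (concat ?B) = {1..length \<alpha>}"
      "length ?B = (if \<alpha> = [] then 1 else dasc d \<alpha> + 2)"
      "\<alpha> \<noteq> [] \<Longrightarrow> \<exists>P c Q. ?B = P @ (length \<alpha> # c) # Q \<and> length P = last \<alpha>"
    using snoc.IH[OF seq] by auto
  have aB: "a < length ?B" using a IH(4) by (auto split: if_splits)
  define P b Q where "P = take a ?B" and "b = ?B ! a" and "Q = drop (Suc a) ?B"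
  have B: "?B = P @ b # Q" and P: "length P = a"
    using aB by (auto simp: P_def b_def Q_def id_take_nth_drop)
  have new: "new_block ?n a ?B = P @ [?n] # b # Q"
    using aB by (simp add: new_block_def P_def b_def Q_def Cons_nth_drop_Suc)
  have join: "join_block ?n a ?B = P @ (?n # b) # Q"
    by (simp add: join_block_def P_def b_def Q_def)
  have below: "\<forall>x\<in>set (concat (P @ b # Q)). x < ?n"
    using IH(3) unfolding B by auto
  have concat: "concat (blocks d (\<alpha> @ [a])) = concat P @ ?n # b @ concat Q"
    using concat_blocks_snoc[OF aB] B P by simp
  have perm: "distinct (concat (blocks d (\<alpha> @ [a])))"
      "set (concat (blocks d (\<alpha> @ [a]))) = {1..length (\<alpha> @ [a])}"
  proof -
    show "distinct (concat (blocks d (\<alpha> @ [a])))"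
      unfolding concat using IH(2) below unfolding B by auto
    have "set (concat (blocks d (\<alpha> @ [a]))) = insert ?n (set (concat ?B))"
      unfolding concat B by auto
    then show "set (concat (blocks d (\<alpha> @ [a]))) = {1..length (\<alpha> @ [a])}"
      unfolding IH(3) by auto
  qed
  show ?case
  proof (cases "\<alpha> = [] \<or> last \<alpha> < a + d")
    case True
    have free: "\<not> has_increasing_below d ?n (concat (b # Q))"
    proof
      assume bad: "has_increasing_below d ?n (concat (b # Q))"
      \<comment> \<open>The subsequence ends in the previous maximum, so this lies in or after the block \<open>b\<close>.\<close>
      have "length \<alpha> \<in> set (concat (b # Q))"
      proof -
        obtain zs where "subseq zs (concat (b # Q))" "length zs = Suc d" "last zs = length \<alpha>"
          using bad unfolding has_increasing_below_def by auto
        moreover from this have "length \<alpha> \<in> set zs"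
          using last_in_set[of zs] by (cases zs) auto
        ultimately show ?thesis by (blast dest: list_emb_set)
      qed
      moreover have "0 \<notin> set (concat ?B)"
        unfolding IH(3) by simp
      then have "0 \<notin> set (concat (b # Q))"
        unfolding B by simp
      ultimately have ne: "\<alpha> \<noteq> []" by fastforce
      obtain R c S where R: "?B = R @ (length \<alpha> # c) # S" "length R = last \<alpha>"
        using IH(5)[OF ne] by blast
      have notin: "length \<alpha> \<notin> set (concat R)" "length \<alpha> \<notin> set c" "length \<alpha> \<notin> set (concat S)"
        using IH(2) unfolding R(1) by auto
      have bQ: "b # Q = drop a ?B" using B P by simp
      have "a \<le> length R"
      proof (rule ccontr)
        assume "\<not> a \<le> length R"
        then have "set (drop a ?B) \<subseteq> set S"
          unfolding R(1) by (auto simp: drop_Cons' dest: in_set_dropD)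
        then show False
          using \<open>length \<alpha> \<in> set (concat (b # Q))\<close> notin(3) unfolding bQ by auto
      qed
      then have drop: "b # Q = drop a R @ (length \<alpha> # c) # S"
        unfolding bQ R(1) by simp
      have "d \<le> length (drop a R)"
      proof (rule increasing_below_le_blocks[OF _ _ notin(2,3)])
        show "has_increasing_below d (Suc (length \<alpha>)) (concat (drop a R @ (length \<alpha> # c) # S))"
          using bad drop by simp
        show "\<forall>b\<in>set (drop a R). sorted_wrt (>) b"
          using good_decreasing[OF IH(1)] unfolding R(1) by (auto dest: in_set_dropD)
      qed
      then show False using True ne R(2) \<open>a \<le> length R\<close> by simp
    qed
    have blk: "blocks d (\<alpha> @ [a]) = P @ [?n] # b # Q"
      using True new by (simp add: blocks_snoc)
    have "good d (blocks d (\<alpha> @ [a]))"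
      unfolding blk using good_new_block IH(1) below free unfolding B by blast
    moreover have "length (blocks d (\<alpha> @ [a])) = dasc d (\<alpha> @ [a]) + 2"
      using IH(4) True unfolding B blk dasc_snoc by (auto simp: dasc_def d_ascents_def)
    ultimately show ?thesis using perm blk P by auto
  next
    case False
    have blk: "blocks d (\<alpha> @ [a]) = P @ (?n # b) # Q"
      using False join by (simp add: blocks_snoc)
    have "good d (blocks d (\<alpha> @ [a]))"
      unfolding blk using good_join IH(1) below unfolding B by blast
    moreover have "length (blocks d (\<alpha> @ [a])) = dasc d (\<alpha> @ [a]) + 2"
      using IH(4) False unfolding B blk dasc_snoc by auto
    ultimately show ?thesis using perm blk P by auto
  qed
qed

lemma less_length_blocks:
  assumes "d_ascent_sequence d (\<alpha> @ [a])"
  shows "a < length (blocks d \<alpha>)"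
proof -
  have "d_ascent_sequence d \<alpha>" "a \<le> (if \<alpha> = [] then 0 else 1 + dasc d \<alpha>)"
    using assms by (auto simp: d_ascent_sequence_snoc)
  moreover from this have "length (blocks d \<alpha>) = (if \<alpha> = [] then 1 else dasc d \<alpha> + 2)"
    using blocks_invariant by blast
  ultimately show ?thesis by (simp split: if_splits)
qed

text \<open>The indices of a good block list name different places, as only its final block may be empty.\<close>

lemma good_concat_take_inj:
  assumes "good d B" "a < length B" "b < length B" "concat (take a B) = concat (take b B)"
  shows "a = b"
proof -
  have less: False
    if ab: "a < b" and "b < length B" "concat (take a B) = concat (take b B)" for a b
  proof -
    have "take b B = take a B @ take (b - a) (drop a B)"
      using that(1) take_add[of a "b - a" B] by simp
    moreover have "drop a B = B ! a # drop (Suc a) B"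
      using that(1,2) by (simp add: Cons_nth_drop_Suc)
    moreover obtain k where "b - a = Suc k"
      using ab by (cases "b - a") auto
    ultimately have "take b B = take a B @ B ! a # take k (drop (Suc a) B)"
      by simp
    then have "B ! a = []" using that(3) by simp
    moreover have "B = take a B @ B ! a # drop (Suc a) B"
      using that by (simp add: id_take_nth_drop)
    moreover have "drop (Suc a) B \<noteq> []" using that by simp
    ultimately show False
      using good_nonempty[of d "take a B" "B ! a" "drop (Suc a) B"] assms(1)
      by simp
  qed
  show ?thesis
    using less[of a b] less[of b a] assms by (cases a b rule: linorder_cases) auto
qed

lemma concat_blocks_inj:
  assumes "d_ascent_sequence d \<alpha>" "d_ascent_sequence d \<beta>" "length \<alpha> = length \<beta>"
    and "concat (blocks d \<alpha>) = concat (blocks d \<beta>)"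
  shows "\<alpha> = \<beta>"
  using assms
proof (induction \<alpha> arbitrary: \<beta> rule: rev_induct)
  case (snoc a \<alpha>)
  obtain b \<beta>' where \<beta>: "\<beta> = \<beta>' @ [b]"
    using snoc.prems(3) by (cases \<beta> rule: rev_cases) auto
  let ?A = "blocks d \<alpha>" and ?B = "blocks d \<beta>'" and ?n = "Suc (length \<alpha>)"
  have len: "length \<beta>' = length \<alpha>" using snoc.prems(3) \<beta> by simp
  have seq: "d_ascent_sequence d \<alpha>" "d_ascent_sequence d \<beta>'"
    using snoc.prems(1,2) \<beta> by (auto simp: d_ascent_sequence_snoc)
  have a: "a < length ?A" and b: "b < length ?B"
    using less_length_blocks snoc.prems(1,2) \<beta> by auto
  have "?n \<notin> set (concat ?A)" "?n \<notin> set (concat ?B)"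
    using blocks_invariant[OF seq(1)] blocks_invariant[OF seq(2)] len by auto
  then have new: "?n \<notin> set (concat (take a ?A))" "?n \<notin> set (concat (drop a ?A))"
      "?n \<notin> set (concat (take b ?B))" "?n \<notin> set (concat (drop b ?B))"
    by (auto dest: in_set_takeD in_set_dropD)
  have "concat (take a ?A) @ ?n # concat (drop a ?A) = concat (take b ?B) @ ?n # concat (drop b ?B)"
    using snoc.prems(4) concat_blocks_snoc[OF a] concat_blocks_snoc[OF b] len \<beta> by simp
  then have eq: "concat (take a ?A) = concat (take b ?B)" "concat (drop a ?A) = concat (drop b ?B)"
    using new by (auto simp: append_Cons_eq_iff)
  then have "concat ?A = concat ?B"
    by (metis append_take_drop_id concat_append)
  then have "\<alpha> = \<beta>'" using snoc.IH seq len by simp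
  moreover have "a = b"
    using good_concat_take_inj[of d ?A a b] blocks_invariant[OF seq(1)] a b eq(1) \<open>\<alpha> = \<beta>'\<close> by simp
  ultimately show ?case using \<beta> by simp
qed simp

theorem theorem4p2:
  fixes d n :: nat
  shows "card (dA d n) \<le> card (Av_sigma d n)"
proof (rule card_inj_on_le)
  show "inj_on (\<lambda>\<alpha>. concat (blocks d \<alpha>)) (dA d n)"
    by (auto simp: inj_on_def dA_def intro: concat_blocks_inj)
  show "(\<lambda>\<alpha>. concat (blocks d \<alpha>)) ` dA d n \<subseteq> Av_sigma d n"
    using blocks_invariant good_avoids
    by (fastforce simp: dA_def Av_sigma_def permutations_of_set_def)
  show "finite (Av_sigma d n)"
    by (rule finite_Av_sigma)
qed

end
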